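(* For every constant $\epsilon>0$ there exist Markov decision processes $\mathcal{M}_{\mathrm{sim}}$ and $\mathcal{M}_{\mathrm{real}}$, sharing the same state space, action space, reward function, discount factor and initial state distribution (they may differ only in their transition dynamics), and a policy $\pi_{\mathrm{base}}$ (the prior), such that an optimal realizable policy exists and: (i) every optimal realizable policy $\pi^*$ satisfies $\mathrm{supp}(\pi^*(\cdot\mid s))\subseteq \mathrm{supp}(\pi_{\mathrm{base}}(\cdot\mid s))$ for all states $s$; (ii) no policy $\pi$ satisfying $W_1(\pi(\cdot\mid s),\pi_{\mathrm{base}}(\cdot\mid s))\le \epsilon$ for all states $s$ is an optimal realizable policy.
   Context: Setting. $\mathcal{M}_{\mathrm{sim}}$ and $\mathcal{M}_{\mathrm{real}}$ are Markov decision processes with common state space $\mathcal{S}$, action space $\mathcal{A}$, reward function $r:\mathcal{S}\times\mathcal{A}\to\mathbb{R}$, discount factor $\gamma\in(0,1)$, horizon $T$ and initial state distribution $p_1$. They differ only in their transition dynamics $p_{\mathrm{sim}}(s_{t+1}\mid s_t,a_t)$ and $p_{\mathrm{real}}(s_{t+1}\mid s_t,a_t)$. A policy $\pi$ assigns to each state $s$ a probability distribution $\pi(\cdot\mid s)$ on $\mathcal{A}$. Its return in simulation is $J_{\mathrm{sim}}(\pi)=\mathbb{E}_{\pi,p_{\mathrm{sim}}}\big[\sum_{t=1}^{T}\gamma^{t-1}r(s_t,a_t)\big]$, with trajectories starting from $s_1\sim p_1$. Realizability. Let $\rho^{\pi}$ denote the state-action visitation measure of $\pi$ in $\mathcal{M}_{\mathrm{real}}$.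 A state-action pair $(s,a)$ is realizable if $\rho^{\pi}(s,a)>0$ (i.e. $\rho^\pi(\{(s,a)\})>0$) for some policy $\pi$, and unrealizable otherwise. By convention, $r(s,a)=0$ whenever $(s,a)$ is unrealizable, and unrealizable pairs result in episode termination in the real world. A policy is realizable if every pair $(s,a)$ in the support of its state-action visitation measure in $\mathcal{M}_{\mathrm{sim}}$ is a realizable pair. An optimal realizable policy is a policy that maximizes $J_{\mathrm{sim}}$ among all realizable policies. $W_1$ denotes the Wasserstein-1 distance between probability measures on the action space (a metric space, e.g. $\mathbb{R}$ with its usual metric), and $\mathrm{supp}$ denotes the topological support of a probability measure. *)

theory Defs
  imports "HOL-Probability.Probability"
begin

text \<open>
  State and action spaces are types with their Borel sigma-algebras; on a discrete countable
  type such as \<^typ>\<open>nat\<close> this is the full power set.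
\<close>

record ('s, 'a) mdp =
  init :: "'s measure"
  transition :: "'s \<times> 'a \<Rightarrow> 's measure"
  reward :: "'s \<Rightarrow> 'a \<Rightarrow> real"
  discount :: real
  horizon :: nat

text \<open>
  Transition kernels are allowed to be sub-probability kernels; the missing mass is the
  probability that the episode terminates instead of moving on to a next state.
\<close>

definition is_mdp ::
  "('s::{second_countable_topology,t2_space}, 'a::{second_countable_topology,metric_space}) mdp \<Rightarrow> bool"
where
  "is_mdp M \<longleftrightarrow>
     init M \<in> space (prob_algebra borel) \<and>
     transition M \<in> borel \<rightarrow>\<^sub>M subprob_algebra borel \<and>
     (\<lambda>(s, a). reward M s a) \<in> borel_measurable borel \<and>
     0 < discount M \<and> discount M < 1 \<and>
     1 \<le> horizon M"

definition policy ::
  "('s::topological_space \<Rightarrow> 'a::topological_space measure) \<Rightarrow> bool"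
where
  "policy \<pi> \<longleftrightarrow> \<pi> \<in> borel \<rightarrow>\<^sub>M prob_algebra borel"

text \<open>
  The law of the first \<open>n\<close> state-action pairs \<open>(s\<^sub>1, a\<^sub>1), \<dots>, (s\<^sub>n, a\<^sub>n)\<close>. Its total mass is the
  probability that the episode has not terminated before step \<open>n\<close>.
\<close>

primrec traj ::
  "('s::{second_countable_topology,t2_space}, 'a::{second_countable_topology,metric_space}) mdp
   \<Rightarrow> ('s \<Rightarrow> 'a measure) \<Rightarrow> nat \<Rightarrow> (nat \<Rightarrow> 's \<times> 'a) measure"
where
  "traj M \<pi> 0 = return (PiM {1..0} (\<lambda>_. borel)) (\<lambda>_. undefined)"
| "traj M \<pi> (Suc n) =
     traj M \<pi> n \<bind> (\<lambda>\<omega>.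
     (if n = 0 then init M else transition M (\<omega> n)) \<bind> (\<lambda>s.
     \<pi> s \<bind> (\<lambda>a.
     return (PiM {1..Suc n} (\<lambda>_. borel)) (fun_upd \<omega> (Suc n) (s, a)))))"

definition total_return ::
  "('s::{second_countable_topology,t2_space}, 'a::{second_countable_topology,metric_space}) mdp
   \<Rightarrow> (nat \<Rightarrow> 's \<times> 'a) \<Rightarrow> real"
where
  "total_return M \<omega> =
     (\<Sum>t = 1..horizon M. discount M ^ (t - 1) * reward M (fst (\<omega> t)) (snd (\<omega> t)))"

text \<open>
  \<open>J\<close> integrates over complete episodes only, so it is the expected return when the transition
  kernel is a probability kernel, as it is in simulation; it is not used for other kernels.
\<close>

definition J ::
  "('s::{second_countable_topology,t2_space}, 'a::{second_countable_topology,metric_space}) mdp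
   \<Rightarrow> ('s \<Rightarrow> 'a measure) \<Rightarrow> real"
where
  "J M \<pi> = (\<integral>\<omega>. total_return M \<omega> \<partial>traj M \<pi> (horizon M))"

text \<open>
  The visitation measure assigns to \<open>B\<close> the expected number of steps \<open>t \<in> {1..T}\<close> with
  \<open>(s\<^sub>t, a\<^sub>t) \<in> B\<close>. Only its null sets and its support are used below, and these do not change
  if the steps are weighted by powers of the discount factor or the measure is normalised.
\<close>

definition visitation ::
  "('s::{second_countable_topology,t2_space}, 'a::{second_countable_topology,metric_space}) mdp
   \<Rightarrow> ('s \<Rightarrow> 'a measure) \<Rightarrow> ('s \<times> 'a) measure"
where
  "visitation M \<pi> = measure_of UNIV (sets borel)
     (\<lambda>B. \<Sum>t = 1..horizon M. emeasure (distr (traj M \<pi> t) borel (\<lambda>\<omega>. \<omega> t)) B)"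

definition supp :: "'a::topological_space measure \<Rightarrow> 'a set" where
  "supp \<mu> = {x. \<forall>U. open U \<longrightarrow> x \<in> U \<longrightarrow> emeasure \<mu> U > 0}"

definition realizable_pair ::
  "('s::{second_countable_topology,t2_space}, 'a::{second_countable_topology,metric_space}) mdp
   \<Rightarrow> 's \<times> 'a \<Rightarrow> bool"
where
  "realizable_pair Mreal x \<longleftrightarrow> (\<exists>\<pi>. policy \<pi> \<and> emeasure (visitation Mreal \<pi>) {x} > 0)"

text \<open>
  The integrability condition says that the expectation defining \<open>J Msim\<close> exists for every
  policy (the Bochner integral would otherwise default to 0). The conditions on \<open>Mreal\<close> say
  that the real episode terminates exactly at the unrealizable pairs.
\<close>

definition sim_real ::
  "('s::{second_countable_topology,t2_space}, 'a::{second_countable_topology,metric_space}) mdp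
   \<Rightarrow> ('s, 'a) mdp \<Rightarrow> bool"
where
  "sim_real Msim Mreal \<longleftrightarrow>
     is_mdp Msim \<and> is_mdp Mreal \<and>
     init Msim = init Mreal \<and> reward Msim = reward Mreal \<and>
     discount Msim = discount Mreal \<and> horizon Msim = horizon Mreal \<and>
     (\<forall>x. prob_space (transition Msim x)) \<and>
     (\<forall>\<pi>. policy \<pi> \<longrightarrow> integrable (traj Msim \<pi> (horizon Msim)) (total_return Msim)) \<and>
     (\<forall>x. realizable_pair Mreal x \<longrightarrow> prob_space (transition Mreal x)) \<and>
     (\<forall>s a. \<not> realizable_pair Mreal (s, a) \<longrightarrow>
        reward Mreal s a = 0 \<and> transition Mreal (s, a) = null_measure borel)"

definition realizable_policy ::
  "('s::{second_countable_topology,t2_space}, 'a::{second_countable_topology,metric_space}) mdp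
   \<Rightarrow> ('s, 'a) mdp \<Rightarrow> ('s \<Rightarrow> 'a measure) \<Rightarrow> bool"
where
  "realizable_policy Msim Mreal \<pi> \<longleftrightarrow>
     policy \<pi> \<and> (\<forall>x \<in> supp (visitation Msim \<pi>). realizable_pair Mreal x)"

definition optimal_realizable ::
  "('s::{second_countable_topology,t2_space}, 'a::{second_countable_topology,metric_space}) mdp
   \<Rightarrow> ('s, 'a) mdp \<Rightarrow> ('s \<Rightarrow> 'a measure) \<Rightarrow> bool"
where
  "optimal_realizable Msim Mreal \<pi> \<longleftrightarrow>
     realizable_policy Msim Mreal \<pi> \<and>
     (\<forall>\<pi>'. realizable_policy Msim Mreal \<pi>' \<longrightarrow> J Msim \<pi>' \<le> J Msim \<pi>)"

text \<open>The marginal conditions force a coupling of two probability measures to be one itself.\<close>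

definition couplings ::
  "'a::topological_space measure \<Rightarrow> 'a measure \<Rightarrow> ('a \<times> 'a) measure set"
where
  "couplings \<mu> \<nu> =
     {\<kappa>. sets \<kappa> = sets borel \<and> distr \<kappa> borel fst = \<mu> \<and> distr \<kappa> borel snd = \<nu>}"

definition W1 ::
  "'a::{second_countable_topology,metric_space} measure \<Rightarrow> 'a measure \<Rightarrow> ennreal"
where
  "W1 \<mu> \<nu> = (INF \<kappa> \<in> couplings \<mu> \<nu>. \<integral>\<^sup>+ z. ennreal (dist (fst z) (snd z)) \<partial>\<kappa>)"

text \<open>On probability measures with this property \<open>W1\<close> is a finite distance.\<close>

definition finite_first_moment :: "'a::metric_space measure \<Rightarrow> bool" where
  "finite_first_moment \<mu> \<longleftrightarrow> (\<exists>x. (\<integral>\<^sup>+ y. ennreal (dist x y) \<partial>\<mu>) < \<infinity>)"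

end

theory Submission
  imports Defs
begin

text \<open>
  A base policy with full support satisfies every support inclusion. Take a one-step problem whose
  only rewarded action is a number \<open>c\<close> far away from the bulk of the base policy: the optimal
  realizable policies play \<open>c\<close> almost surely, and transporting the base policy to the point
  mass at \<open>c\<close> costs at least \<open>c\<close> minus the mean absolute value of the base policy.
\<close>

section \<open>Policies and the law of a one-step episode\<close>

lemma policy_prob_space:
  assumes "policy \<pi>"
  shows "prob_space (\<pi> s)" "sets (\<pi> s) = sets borel"
proof -
  have "\<pi> s \<in> space (prob_algebra borel)"
    using assms measurable_space[of \<pi> borel "prob_algebra borel" s] by (simp add: policy_def)
  then show "prob_space (\<pi> s)" "sets (\<pi> s) = sets borel"
    by (auto simp: space_prob_algebra)
qed

lemma policy_const:
  assumes "prob_space \<mu>" "sets \<mu> = sets borel"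
  shows "policy (\<lambda>_. \<mu>)"
  unfolding policy_def using assms by (intro measurable_const) (simp add: space_prob_algebra)

text \<open>Binding a point mass evaluates the kernel at that point, and binding into
  \<open>return\<close> is a pushforward. Hence the empty history and the deterministic start state
  drop out, and only the draw of the action at \<open>s0\<close> remains random.\<close>

lemma traj_1_init_return:
  fixes M :: "('s::{second_countable_topology,t2_space}, 'a::{second_countable_topology,metric_space}) mdp"
  assumes init: "init M = return borel s0" and pol: "policy \<pi>"
  shows "traj M \<pi> (Suc 0) =
    distr (\<pi> s0) (PiM {Suc 0} (\<lambda>_. borel)) (\<lambda>a. (\<lambda>_. undefined)(Suc 0 := (s0, a)))"
proof -
  define N :: "(nat \<Rightarrow> 's \<times> 'a) measure" where "N = PiM {Suc 0} (\<lambda>_. borel)"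
  define u :: "nat \<Rightarrow> 's \<times> 'a" where "u = (\<lambda>_. undefined)"
  \<comment> \<open>\<open>F\<close> is the whole first step as a kernel from histories, and
    \<open>u\<close> is the empty history.\<close>
  define F where "F \<omega> = (return borel s0 \<bind> (\<lambda>s. \<pi> s \<bind>
    (\<lambda>a. return N (fun_upd \<omega> (Suc 0) (s, a)))))" for \<omega>
  have "(\<lambda>v. u(Suc 0 := v)) \<in> borel \<rightarrow>\<^sub>M N"
    using measurable_component_update[of u "{}" "\<lambda>_. borel" "Suc 0"]
    by (simp add: N_def u_def space_PiM)
  moreover have "(\<lambda>(s, a). (s, a)) \<in> borel \<Otimes>\<^sub>M borel \<rightarrow>\<^sub>M (borel :: ('s \<times> 'a) measure)"
    by (simp add: borel_prod)
  ultimately have upd: "(\<lambda>(s, a). u(Suc 0 := (s, a))) \<in> borel \<Otimes>\<^sub>M borel \<rightarrow>\<^sub>M N"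
    using measurable_comp[of "\<lambda>(s, a). (s, a)" "borel \<Otimes>\<^sub>M borel" borel "\<lambda>v. u(Suc 0 := v)" N]
    by (simp add: comp_def case_prod_unfold)
  have upd_s: "(\<lambda>a. u(Suc 0 := (s, a))) \<in> \<pi> s \<rightarrow>\<^sub>M N" for s
    using measurable_Pair2[OF upd, of s] policy_prob_space(2)[OF pol, of s]
    by (simp cong: measurable_cong_sets)
  have step: "\<pi> s \<bind> (\<lambda>a. return N (u(Suc 0 := (s, a)))) = distr (\<pi> s) N (\<lambda>a. u(Suc 0 := (s, a)))"
    for s
    using upd_s policy_prob_space(1)[OF pol, of s]
    by (intro bind_return_distr') (auto simp: prob_space.not_empty)
  \<comment> \<open>Removing the point mass at \<open>s0\<close> with \<open>bind_return\<close>
    requires measurability in the state variable, hence the law of the step as a function of all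
    states.\<close>
  have "\<pi> \<in> borel \<rightarrow>\<^sub>M subprob_algebra borel"
    using pol unfolding policy_def by (rule measurable_prob_algebraD)
  then have "(\<lambda>s. distr (\<pi> s) N (\<lambda>a. u(Suc 0 := (s, a)))) \<in> borel \<rightarrow>\<^sub>M subprob_algebra N"
    by (intro measurable_distr2[OF upd])
  then have Fu: "F u = distr (\<pi> s0) N (\<lambda>a. u(Suc 0 := (s0, a)))"
    unfolding F_def step by (subst bind_return) auto
  have "F u \<in> space (subprob_algebra N)"
    unfolding Fu using upd_s[of s0] policy_prob_space(1)[OF pol, of s0]
    by (auto simp: space_subprob_algebra
        intro!: prob_space_imp_subprob_space prob_space.prob_space_distr)
  \<comment> \<open>A product over the empty index set has a single point, so \<open>F\<close>
    agrees on it with a constant function and is measurable for that reason.\<close>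
  moreover have sp: "space (PiM {} (\<lambda>_. borel)) = {u}"
    by (simp add: u_def space_PiM)
  ultimately have "F \<in> PiM {} (\<lambda>_. borel) \<rightarrow>\<^sub>M subprob_algebra N"
    by (subst measurable_cong[where g = "\<lambda>_. F u"]) auto
  then have "return (PiM {} (\<lambda>_. borel)) u \<bind> F = F u"
    using sp by (intro bind_return) auto
  then show ?thesis
    unfolding Fu by (simp add: F_def[abs_def] init N_def u_def)
qed

lemma measurable_first_step:
  "(\<lambda>a. (\<lambda>_. undefined)(Suc 0 := (s0, a))) \<in> borel \<rightarrow>\<^sub>M
    PiM {Suc 0} (\<lambda>_. borel :: ('s::second_countable_topology \<times> 'a::second_countable_topology) measure)"
proof -
  have "(\<lambda>v. (\<lambda>_. undefined)(Suc 0 := v)) \<in> borel \<rightarrow>\<^sub>M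
      PiM {Suc 0} (\<lambda>_. borel :: ('s \<times> 'a) measure)"
    using measurable_component_update[of "\<lambda>_. undefined" "{}" "\<lambda>_. borel" "Suc 0"]
    by (simp add: space_PiM)
  moreover have "Pair s0 \<in> borel \<rightarrow>\<^sub>M (borel :: ('s \<times> 'a) measure)"
    unfolding borel_prod[symmetric] by (rule measurable_Pair1') simp
  ultimately show ?thesis
    using measurable_comp[of "Pair s0"] by (fastforce simp: comp_def)
qed

text \<open>With one step the defining sum has a single term, and \<open>measure_of\<close> applied
  to the values of a Borel measure gives that measure back.\<close>

lemma visitation_horizon_1:
  fixes M :: "('s::{second_countable_topology,t2_space}, 'a::{second_countable_topology,metric_space}) mdp"
  assumes "init M = return borel s0" "horizon M = 1" and pol: "policy \<pi>"
  shows "visitation M \<pi> = distr (\<pi> s0) borel (Pair s0)"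
proof -
  have "distr (traj M \<pi> (Suc 0)) borel (\<lambda>\<omega>. \<omega> (Suc 0)) = distr (\<pi> s0) borel (Pair s0)"
    unfolding traj_1_init_return[OF assms(1) pol]
    using measurable_first_step[of s0, where 'a = 'a] policy_prob_space(2)[OF pol]
    by (subst distr_distr) (auto simp: comp_def cong: measurable_cong_sets)
  then show ?thesis
    using measure_of_of_measure[of "distr (\<pi> s0) borel (Pair s0)"] assms(2)
    by (simp add: visitation_def)
qed

text \<open>Both claims are a change of variables along the map from the action to the one-step
  trajectory. The second one reduces the integrability condition of \<open>sim_real\<close> to the
  reward at the start state.\<close>

lemma return_horizon_1:
  fixes M :: "('s::{second_countable_topology,t2_space}, 'a::{second_countable_topology,metric_space}) mdp"
  assumes M: "is_mdp M" "init M = return borel s0" "horizon M = 1" and pol: "policy \<pi>"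
  shows "J M \<pi> = (\<integral>a. reward M s0 a \<partial>\<pi> s0)"
    and "integrable (traj M \<pi> (horizon M)) (total_return M) \<longleftrightarrow> integrable (\<pi> s0) (reward M s0)"
proof -
  have rew: "(\<lambda>x. reward M (fst x) (snd x)) \<in> borel_measurable borel"
    using M(1) by (simp add: is_mdp_def case_prod_unfold)
  have meas: "total_return M \<in> borel_measurable (PiM {Suc 0} (\<lambda>_. borel))"
    unfolding total_return_def[abs_def] using M(3)
    by (auto intro!: measurable_compose[OF _ rew, of "\<lambda>\<omega>. \<omega> (Suc 0)"])
  have upd: "(\<lambda>a. (\<lambda>_. undefined)(Suc 0 := (s0, a))) \<in>
      \<pi> s0 \<rightarrow>\<^sub>M PiM {Suc 0} (\<lambda>_. borel :: ('s \<times> 'a) measure)"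
    using measurable_first_step policy_prob_space(2)[OF pol] by (simp cong: measurable_cong_sets)
  \<comment> \<open>At \<open>t = 1\<close> the exponent \<open>t - 1\<close> is 0, so the reward
    enters undiscounted.\<close>
  have ret: "total_return M ((\<lambda>_. undefined)(Suc 0 := (s0, a))) = reward M s0 a" for a
    by (simp add: total_return_def M(3))
  show "J M \<pi> = (\<integral>a. reward M s0 a \<partial>\<pi> s0)"
    unfolding J_def M(3) One_nat_def traj_1_init_return[OF M(2) pol]
    by (simp only: integral_distr[OF upd meas] ret)
  show "integrable (traj M \<pi> (horizon M)) (total_return M) \<longleftrightarrow> integrable (\<pi> s0) (reward M s0)"
    unfolding M(3) One_nat_def traj_1_init_return[OF M(2) pol]
    by (simp only: integrable_distr_eq[OF upd meas] ret)
qed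

section \<open>The normal base policy and a lower bound for \<open>W1\<close>\<close>

text \<open>The density is positive everywhere, so an open set of normal measure 0 would be Lebesgue
  null, although it contains an interval of positive length if it is nonempty.\<close>

lemma supp_std_normal: "supp std_normal_distribution = UNIV"
proof -
  have "emeasure std_normal_distribution U > 0" if "open U" "x \<in> U" for U :: "real set" and x
  proof (rule ccontr)
    assume "\<not> ?thesis"
    then have "U \<in> null_sets std_normal_distribution"
      using that(1) by (auto simp: null_sets_def)
    then have "AE y in lborel. y \<in> U \<longrightarrow> ennreal (std_normal_density y) = 0"
      by (simp add: null_sets_density_iff)
    \<comment> \<open>Since \<open>ennreal\<close> sends all nonpositive reals to 0, a vanishing
      \<open>ennreal\<close> value only says that the density is \<open>\<le> 0\<close>.\<close>
    moreover have "\<not> std_normal_density y \<le> 0" for y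
      using normal_density_pos[of 1 0 y] by linarith
    ultimately have "AE y in lborel. y \<notin> U"
      by (simp add: ennreal_eq_0_iff)
    then have "U \<in> null_sets lborel"
      using that(1) by (subst AE_iff_null_sets) simp_all
    moreover obtain e where "e > 0" "cball x e \<subseteq> U"
      using \<open>open U\<close> \<open>x \<in> U\<close> unfolding open_contains_cball by blast
    ultimately have "cball x e \<in> null_sets lborel"
      by (intro null_sets_subset[of U lborel "cball x e"]) simp_all
    with \<open>e > 0\<close> show False
      by (simp add: null_sets_def cball_eq_atLeastAtMost)
  qed
  then show ?thesis
    by (auto simp: supp_def)
qed

lemma std_normal_first_moment_finite: "(\<integral>\<^sup>+ y. ennreal \<bar>y\<bar> \<partial>std_normal_distribution) < \<infinity>"
  using integrable_std_normal_distribution_moment[of 1] by (simp add: integrable_iff_bounded)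

text \<open>Under any coupling the first coordinate is almost surely \<open>c\<close>, so
  integrating the triangle inequality bounds \<open>c\<close> by the transport cost plus the first
  absolute moment of \<open>\<nu>\<close>. The bound holds coupling by coupling and so passes to the
  infimum.\<close>

lemma W1_ge_point_mass:
  fixes \<mu> \<nu> :: "real measure"
  assumes \<mu>: "prob_space \<mu>" "sets \<mu> = sets borel" "AE a in \<mu>. a = c"
    and moment: "(\<integral>\<^sup>+ y. ennreal \<bar>y\<bar> \<partial>\<nu>) \<le> ennreal m" and "0 \<le> m" "0 \<le> c"
  shows "ennreal (c - m) \<le> W1 \<mu> \<nu>"
  unfolding W1_def
proof (rule INF_greatest)
  fix \<kappa> assume "\<kappa> \<in> couplings \<mu> \<nu>"
  then have \<kappa>: "sets \<kappa> = sets borel" "distr \<kappa> borel fst = \<mu>" "distr \<kappa> borel snd = \<nu>"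
    by (auto simp: couplings_def)
  have fst: "fst \<in> \<kappa> \<rightarrow>\<^sub>M borel" and snd: "snd \<in> \<kappa> \<rightarrow>\<^sub>M borel"
    unfolding measurable_cong_sets[OF \<kappa>(1) refl] borel_prod[symmetric] by measurable
  \<comment> \<open>A pushforward preserves total mass, so a probability marginal makes the coupling
    a probability measure; this lets the constant \<open>c\<close> integrate to
    \<open>c\<close>.\<close>
  have "prob_space \<kappa>"
    using \<mu>(1) fst unfolding \<kappa>(2)[symmetric] by (rule prob_space_distrD[rotated])
  moreover have "AE z in \<kappa>. fst z = c"
    using \<mu>(3) unfolding \<kappa>(2)[symmetric] by (subst (asm) AE_distr_iff[OF fst]) auto
  ultimately have "ennreal c = (\<integral>\<^sup>+ z. ennreal \<bar>fst z\<bar> \<partial>\<kappa>)"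
    using \<open>0 \<le> c\<close> by (subst nn_integral_cong_AE[where v = "\<lambda>_. ennreal c"])
      (auto simp: prob_space.emeasure_space_1)
  also have "\<dots> \<le> (\<integral>\<^sup>+ z. ennreal (dist (fst z) (snd z)) + ennreal \<bar>snd z\<bar> \<partial>\<kappa>)"
    by (intro nn_integral_mono) (auto simp flip: ennreal_plus simp: dist_real_def intro!: ennreal_leI)
  also have "\<dots> = (\<integral>\<^sup>+ z. ennreal (dist (fst z) (snd z)) \<partial>\<kappa>) + (\<integral>\<^sup>+ z. ennreal \<bar>snd z\<bar> \<partial>\<kappa>)"
    using fst snd by (intro nn_integral_add) auto
  also have "(\<integral>\<^sup>+ z. ennreal \<bar>snd z\<bar> \<partial>\<kappa>) = (\<integral>\<^sup>+ y. ennreal \<bar>y\<bar> \<partial>\<nu>)"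
    unfolding \<kappa>(3)[symmetric] by (subst nn_integral_distr[OF snd]) auto
  finally have "ennreal c \<le> (\<integral>\<^sup>+ z. ennreal (dist (fst z) (snd z)) \<partial>\<kappa>) + ennreal m"
    using moment by (meson add_left_mono order_trans)
  \<comment> \<open>If \<open>c < m\<close>, the left side is 0 by truncation, in agreement with
    subtraction in \<open>ennreal\<close>.\<close>
  then show "ennreal (c - m) \<le> (\<integral>\<^sup>+ z. ennreal (dist (fst z) (snd z)) \<partial>\<kappa>)"
    using \<open>0 \<le> m\<close> by (simp add: ennreal_minus[symmetric] ennreal_minus_le_iff add.commute)
qed

section \<open>The one-step decision problem\<close>

text \<open>Taking the kernel as a parameter makes simulation and reality share everything else by
  construction.\<close>

definition one_step_mdp :: "real \<Rightarrow> (nat \<times> real \<Rightarrow> nat measure) \<Rightarrow> (nat, real) mdp" where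
  "one_step_mdp c K = \<lparr>init = return borel 0, transition = K,
     reward = (\<lambda>s a. indicator {(0, c)} (s, a)), discount = 1 / 2, horizon = 1\<rparr>"

definition sim_kernel :: "nat \<times> real \<Rightarrow> nat measure" where
  "sim_kernel x = return borel 0"

text \<open>The single step takes place in state 0, so the pairs with another state are the
  unrealizable ones, and the episode has to terminate there.\<close>

definition real_kernel :: "nat \<times> real \<Rightarrow> nat measure" where
  "real_kernel x = (if fst x = 0 then return borel 0 else null_measure borel)"

lemma is_mdp_one_step:
  assumes "K \<in> borel \<rightarrow>\<^sub>M subprob_algebra borel"
  shows "is_mdp (one_step_mdp c K)"
  using assms
  by (auto simp: is_mdp_def one_step_mdp_def case_prod_unfold space_prob_algebra prob_space_return)

lemma measurable_sim_kernel: "sim_kernel \<in> borel \<rightarrow>\<^sub>M subprob_algebra borel"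
  unfolding sim_kernel_def[abs_def]
  by (intro measurable_const)
    (auto simp: space_subprob_algebra intro!: prob_space_imp_subprob_space prob_space_return)

lemma measurable_real_kernel: "real_kernel \<in> borel \<rightarrow>\<^sub>M subprob_algebra borel"
proof -
  have "{x \<in> space borel. fst x = (0::nat)} \<in> sets (borel :: (nat \<times> real) measure)"
    unfolding borel_prod[symmetric] by measurable
  then show ?thesis
    unfolding real_kernel_def[abs_def]
    by (intro measurable_If measurable_const)
      (auto simp: space_subprob_algebra subprob_space_null_measure
        intro!: prob_space_imp_subprob_space prob_space_return)
qed

lemma visitation_one_step:
  "policy \<pi> \<Longrightarrow> visitation (one_step_mdp c K) \<pi> = distr (\<pi> 0) borel (Pair 0)"
  by (intro visitation_horizon_1) (auto simp: one_step_mdp_def)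

text \<open>The reward in state 0 is the indicator of \<open>c\<close>, so maximising the return
  means maximising the mass of one atom.\<close>

lemma J_one_step:
  assumes "K \<in> borel \<rightarrow>\<^sub>M subprob_algebra borel" and pol: "policy \<pi>"
  shows "J (one_step_mdp c K) \<pi> = measure (\<pi> 0) {c}"
proof -
  have "J (one_step_mdp c K) \<pi> = (\<integral>a. reward (one_step_mdp c K) 0 a \<partial>\<pi> 0)"
    by (rule return_horizon_1(1)[OF is_mdp_one_step[OF assms(1)] _ _ pol])
      (auto simp: one_step_mdp_def)
  also have "\<dots> = (\<integral>a. indicator {c} a \<partial>\<pi> 0)"
    by (intro Bochner_Integration.integral_cong) (auto simp: one_step_mdp_def indicator_def)
  also have "\<dots> = measure (\<pi> 0) {c}"
    using policy_prob_space(2)[OF pol, of 0] by (simp add: sets_eq_imp_space_eq)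
  finally show ?thesis .
qed

section \<open>Realizable and optimal policies of the one-step problem\<close>

lemma emeasure_distr_Pair:
  fixes \<mu> :: "real measure"
  assumes "sets \<mu> = sets borel" "B \<in> sets (borel :: (nat \<times> real) measure)"
  shows "emeasure (distr \<mu> borel (Pair s)) B = emeasure \<mu> (Pair s -` B)"
proof -
  have "Pair s \<in> \<mu> \<rightarrow>\<^sub>M (borel :: (nat \<times> real) measure)"
    unfolding borel_prod[symmetric] measurable_cong_sets[OF assms(1) refl]
    by (rule measurable_Pair1') simp
  then show ?thesis
    using assms by (simp add: emeasure_distr sets_eq_imp_space_eq)
qed

text \<open>Visitation is concentrated on state 0. Conversely, realizability asks for positive mass
  at a single point of a continuum of actions, and the deterministic policy playing \<open>a\<close>
  provides it.\<close>

lemma realizable_pair_one_step: "realizable_pair (one_step_mdp c K) (s, a) \<longleftrightarrow> s = 0"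
proof
  assume "realizable_pair (one_step_mdp c K) (s, a)"
  then obtain \<pi> where \<pi>: "policy \<pi>" "emeasure (visitation (one_step_mdp c K) \<pi>) {(s, a)} > 0"
    by (auto simp: realizable_pair_def)
  then have "emeasure (\<pi> 0) (Pair 0 -` {(s, a)}) > 0"
    using policy_prob_space(2)[OF \<pi>(1), of 0] by (simp add: visitation_one_step emeasure_distr_Pair)
  then have "Pair 0 -` {(s, a)} \<noteq> {}"
    by (metis emeasure_empty less_irrefl)
  then show "s = 0"
    by auto
next
  assume "s = 0"
  have pol: "policy (\<lambda>_. return borel a)"
    by (intro policy_const prob_space_return) auto
  have "Pair 0 -` {(0::nat, a)} = {a}"
    by auto
  with \<open>s = 0\<close> have "emeasure (visitation (one_step_mdp c K) (\<lambda>_. return borel a)) {(s, a)} = 1"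
    by (simp add: visitation_one_step[OF pol] emeasure_distr_Pair)
  with pol show "realizable_pair (one_step_mdp c K) (s, a)"
    unfolding realizable_pair_def by (intro exI[of _ "\<lambda>_. return borel a"]) simp
qed

text \<open>A topological support may contain limit points that carry no mass. Here the states are
  discrete, so the slice over a state \<open>s \<noteq> 0\<close> is an open null set and keeps the
  support inside state 0.\<close>

lemma realizable_policy_one_step:
  "realizable_policy (one_step_mdp c K) (one_step_mdp c K') \<pi> \<longleftrightarrow> policy \<pi>"
proof -
  have "s = 0" if pol: "policy \<pi>" and x: "(s, a) \<in> supp (visitation (one_step_mdp c K) \<pi>)" for s a
  proof (rule ccontr)
    assume "s \<noteq> 0"
    have "open ({s} \<times> (UNIV :: real set))"
      by (intro open_Times) (auto intro: discrete_topology_class.open_discrete)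
    with x have "emeasure (visitation (one_step_mdp c K) \<pi>) ({s} \<times> UNIV) > 0"
      by (auto simp: supp_def)
    moreover have "Pair 0 -` ({s} \<times> (UNIV :: real set)) = {}"
      using \<open>s \<noteq> 0\<close> by auto
    ultimately show False
      using \<open>open _\<close> policy_prob_space(2)[OF pol, of 0]
      by (simp add: visitation_one_step[OF pol] emeasure_distr_Pair borel_open)
  qed
  then show ?thesis
    by (auto simp: realizable_policy_def realizable_pair_one_step)
qed

text \<open>The reward in state 0 is the indicator of a Borel set, hence integrable under any
  policy. At pairs with another state both the reward and \<open>real_kernel\<close> vanish, as the
  termination convention demands.\<close>

lemma sim_real_one_step:
  "sim_real (one_step_mdp c sim_kernel) (one_step_mdp c real_kernel)"
proof -
  have "integrable (traj (one_step_mdp c sim_kernel) \<pi> (horizon (one_step_mdp c sim_kernel)))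
      (total_return (one_step_mdp c sim_kernel))" if pol: "policy \<pi>" for \<pi>
  proof -
    interpret prob_space "\<pi> 0"
      by (rule policy_prob_space(1)[OF pol])
    have "integrable (\<pi> 0) (indicator {c} :: real \<Rightarrow> real)"
      using policy_prob_space(2)[OF pol, of 0] by (simp add: less_top[symmetric])
    also have "indicator {c} = reward (one_step_mdp c sim_kernel) 0"
      by (auto simp: one_step_mdp_def indicator_def)
    finally show ?thesis
      by (subst return_horizon_1(2)[OF is_mdp_one_step[OF measurable_sim_kernel] _ _ pol])
        (auto simp: one_step_mdp_def)
  qed
  then show ?thesis
    using is_mdp_one_step[OF measurable_sim_kernel] is_mdp_one_step[OF measurable_real_kernel]
    unfolding sim_real_def
    by (auto simp: realizable_pair_one_step)
      (auto simp: one_step_mdp_def sim_kernel_def real_kernel_def prob_space_return)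
qed

text \<open>All policies compete, and the upper bound 1 on the mass of \<open>{c}\<close> is
  attained by the point mass at \<open>c\<close>. Optimality leaves the policy free in states other
  than 0.\<close>

lemma optimal_realizable_one_step:
  "optimal_realizable (one_step_mdp c sim_kernel) (one_step_mdp c K) \<pi> \<longleftrightarrow>
    policy \<pi> \<and> measure (\<pi> 0) {c} = 1"
proof -
  have le1: "measure (\<pi>' 0) {c} \<le> 1" if "policy \<pi>'" for \<pi>'
    using policy_prob_space(1)[OF that] by (rule prob_space.prob_le_1)
  have c: "policy (\<lambda>_. return borel c)" "measure (return borel c) {c} = 1"
    by (auto simp: measure_return intro!: policy_const prob_space_return)
  have "(\<forall>\<pi>'. policy \<pi>' \<longrightarrow> measure (\<pi>' 0) {c} \<le> measure (\<pi> 0) {c}) \<longleftrightarrow>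
      measure (\<pi> 0) {c} = 1" if "policy \<pi>"
    using c le1 that by (metis order_antisym)
  then show ?thesis
    unfolding optimal_realizable_def realizable_policy_one_step
    using J_one_step[OF measurable_sim_kernel] by auto
qed

theorem propositionE2:
  fixes \<epsilon> :: real
  assumes "\<epsilon> > 0"
  shows "\<exists>(Msim :: (nat, real) mdp) (Mreal :: (nat, real) mdp) (\<pi>base :: nat \<Rightarrow> real measure).
    sim_real Msim Mreal \<and>
    policy \<pi>base \<and> (\<forall>s. finite_first_moment (\<pi>base s)) \<and>
    (\<exists>\<pi>. optimal_realizable Msim Mreal \<pi>) \<and>
    (\<forall>\<pi>. optimal_realizable Msim Mreal \<pi> \<longrightarrow> (\<forall>s. supp (\<pi> s) \<subseteq> supp (\<pi>base s))) \<and>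
    (\<forall>\<pi>. policy \<pi> \<and> (\<forall>s. W1 (\<pi> s) (\<pi>base s) \<le> ennreal \<epsilon>) \<longrightarrow>
         \<not> optimal_realizable Msim Mreal \<pi>)"
proof -
  obtain m where m: "0 \<le> m" "(\<integral>\<^sup>+ y. ennreal \<bar>y\<bar> \<partial>std_normal_distribution) = ennreal m"
    using std_normal_first_moment_finite by (auto simp: less_top_ennreal)
  \<comment> \<open>The transport bound \<open>c - m\<close> becomes \<open>2 * \<epsilon>\<close>,
    which exceeds \<open>\<epsilon>\<close>.\<close>
  define c where "c = m + 2 * \<epsilon>"
  let ?Msim = "one_step_mdp c sim_kernel" and ?Mreal = "one_step_mdp c real_kernel"
  \<comment> \<open>Full support in every state gives the inclusion of supports also where an
    optimal policy is arbitrary.\<close>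
  let ?\<pi>base = "\<lambda>_ :: nat. std_normal_distribution"
  have "policy ?\<pi>base"
    by (intro policy_const prob_space_normal_density) auto
  moreover have "finite_first_moment std_normal_distribution"
    using std_normal_first_moment_finite
    by (auto simp: finite_first_moment_def dist_real_def intro!: exI[of _ 0])
  moreover have "optimal_realizable ?Msim ?Mreal (\<lambda>_. return borel c)"
    by (auto simp: optimal_realizable_one_step measure_return intro!: policy_const prob_space_return)
  moreover have "\<not> optimal_realizable ?Msim ?Mreal \<pi>"
    if "policy \<pi>" "\<forall>s. W1 (\<pi> s) (?\<pi>base s) \<le> ennreal \<epsilon>" for \<pi>
  proof
    assume "optimal_realizable ?Msim ?Mreal \<pi>"
    then have 1: "measure (\<pi> 0) {c} = 1"
      by (simp add: optimal_realizable_one_step)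
    interpret prob_space "\<pi> 0"
      by (rule policy_prob_space(1)[OF that(1)])
    have "{c} \<in> sets (\<pi> 0)"
      using policy_prob_space(2)[OF that(1), of 0] by simp
    with 1 have "AE a in \<pi> 0. a = c"
      by (simp add: prob_eq_1)
    then have "ennreal (c - m) \<le> W1 (\<pi> 0) std_normal_distribution"
      using m assms policy_prob_space[OF that(1), of 0]
      by (intro W1_ge_point_mass) (auto simp: c_def)
    also have "\<dots> \<le> ennreal \<epsilon>"
      using that(2) by auto
    finally show False
      using assms by (simp add: c_def)
  qed
  ultimately show ?thesis
    by (intro exI[of _ ?Msim] exI[of _ ?Mreal] exI[of _ ?\<pi>base])
      (auto simp: sim_real_one_step supp_std_normal)
qed

end
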